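(* Let $c:\mathbb{Z}\to\mathbb{C}$ be a periodic function with minimum period $n$, and let $m$ be a nonnegative integer. Then the power series $\sum_{k\ge 0} c(k)\,k^m x^k$ is (the expansion at $0$ of) a rational function of $x$ all of whose poles are $n$-th roots of unity, and each of its poles has order exactly $m+1$.
   Context: The minimum period of a periodic function $c:\mathbb{Z}\to\mathbb{C}$ is the smallest positive integer $p$ with $c(k+p)=c(k)$ for all $k\in\mathbb{Z}$. The convention $k^0=1$ for all $k$ (including $k=0$) is used. Poles are those of the rational function in the complex plane; not every $n$-th root of unity is claimed to be a pole. *)

theory Defs
  imports "HOL-Complex_Analysis.Complex_Analysis"
begin

definition period :: "(int \<Rightarrow> 'a) \<Rightarrow> nat \<Rightarrow> bool" where
  "period c p \<longleftrightarrow> p > 0 \<and> (\<forall>k. c (k + int p) = c k)"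

definition minimum_period :: "(int \<Rightarrow> 'a) \<Rightarrow> nat \<Rightarrow> bool" where
  "minimum_period c n \<longleftrightarrow> period c n \<and> (\<forall>p. period c p \<longrightarrow> n \<le> p)"

end

theory Submission
  imports Defs
begin

text \<open>
  The Euler operator \<open>\<theta> = x d/dx\<close> multiplies the \<open>k\<close>-th coefficient by \<open>k\<close>, so the series is
  \<open>\<theta>\<^sup>m\<close> applied to \<open>C / (1 - x\<^sup>n)\<close>, where \<open>C\<close> is the sum over one period. The roots of
  \<open>1 - x\<^sup>n\<close> are simple and nonzero; hence \<open>C / (1 - x\<^sup>n)\<close> is, at each of them, either regular
  or has a simple pole, \<open>\<theta>\<close> preserves regularity, and it raises the order of a pole by one.
\<close>

text \<open>The numerator of \<open>\<theta>\<close> applied \<open>m\<close> times to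
  \<open>C / W\<close> over the unreduced denominator \<open>W ^ Suc m\<close>: the recursion is the
  quotient rule times \<open>x\<close>. Leaving the fraction unreduced postpones all cancellation to
  a local study at each root of \<open>W\<close>.\<close>

primrec euler_num :: "'a::idom poly \<Rightarrow> 'a poly \<Rightarrow> nat \<Rightarrow> 'a poly" where
  "euler_num C W 0 = C"
| "euler_num C W (Suc m) =
     [:0, 1:] * (W * pderiv (euler_num C W m) - of_nat (Suc m) * pderiv W * euler_num C W m)"

lemma fps_mult_power_eq_euler_num:
  fixes C W :: "complex poly"
  assumes "Abs_fps a * fps_of_poly W = fps_of_poly C"
  shows "Abs_fps (\<lambda>k. a k * of_nat k ^ m) * fps_of_poly W ^ Suc m = fps_of_poly (euler_num C W m)"
proof (induction m)
  case 0
  then show ?case using assms by simp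
next
  case (Suc m)
  define F where "F = Abs_fps (\<lambda>k. a k * of_nat k ^ m)"
  define w where "w = fps_of_poly W"
  have theta: "Abs_fps (\<lambda>k. a k * of_nat k ^ Suc m) = fps_X * fps_deriv F"
    by (rule fps_ext) (auto simp: F_def)
  have D: "fps_deriv (F * w ^ Suc m) = fps_deriv F * w ^ Suc m + of_nat (Suc m) * F * w ^ m * fps_deriv w"
    by (simp add: fps_deriv_power' mult_ac del: power_Suc of_nat_Suc)
  \<comment> \<open>Multiplying \<open>D\<close> by \<open>w\<close> and solving for
    \<open>fps_deriv F * w ^ Suc (Suc m)\<close> leaves only the product
    \<open>F * w ^ Suc m\<close>, which the induction hypothesis identifies.\<close>
  have "fps_X * fps_deriv F * w ^ Suc (Suc m) =
      fps_X * (w * fps_deriv (F * w ^ Suc m) - of_nat (Suc m) * fps_deriv w * (F * w ^ Suc m))"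
    unfolding D by (simp add: algebra_simps)
  also have "\<dots> = fps_of_poly (euler_num C W (Suc m))"
    unfolding F_def w_def Suc.IH euler_num.simps fps_of_poly_mult fps_of_poly_diff fps_of_poly_pderiv
    by (simp add: of_nat_poly fps_of_poly_const fps_of_nat del: of_nat_Suc)
  finally show ?case unfolding theta w_def .
qed

text \<open>At a root of \<open>W\<close> the term with the factor \<open>W\<close> drops out, so
  each step multiplies the value by \<open>- (m + 1) * z * W'(z)\<close>, which is nonzero.\<close>

lemma poly_euler_num_nonzero:
  fixes C W :: "complex poly"
  assumes "z \<noteq> 0" "poly W z = 0" "poly (pderiv W) z \<noteq> 0" "poly C z \<noteq> 0"
  shows "poly (euler_num C W m) z \<noteq> 0"
proof (induction m)
  case (Suc m)
  have "(of_nat (Suc m) :: complex) \<noteq> 0" by (rule of_nat_neq_0)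
  with Suc assms show ?case by (simp del: of_nat_Suc)
qed (use assms in simp)

text \<open>The regular case: a factor of \<open>W\<close> that already cancels in
  \<open>C / W\<close> cancels to the full power after every application of
  \<open>\<theta>\<close>.\<close>

lemma power_dvd_euler_num:
  fixes C W :: "'a::idom poly"
  assumes "[:-z, 1:] dvd W" "[:-z, 1:] dvd C"
  shows "[:-z, 1:] ^ Suc m dvd euler_num C W m"
proof (induction m)
  case 0
  then show ?case using assms by simp
next
  case (Suc m)
  define L where "L = [:-z, 1:]"
  obtain E where E: "W = L * E" using assms(1) unfolding L_def by (elim dvdE)
  obtain R where R: "euler_num C W m = L ^ Suc m * R" using Suc unfolding L_def by (elim dvdE)
  have L': "pderiv L = 1" by (simp add: L_def pderiv_pCons)
  have W': "pderiv W = E + L * pderiv E"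
    by (simp add: E pderiv_mult L' algebra_simps)
  have N': "pderiv (euler_num C W m) = of_nat (Suc m) * L ^ m * R + L ^ Suc m * pderiv R"
    unfolding R pderiv_mult pderiv_power_Suc L'
    by (simp add: mult_ac del: power_Suc of_nat_Suc flip: of_nat_mult_conv_smult)
  \<comment> \<open>The terms \<open>of_nat (Suc m) * L ^ Suc m * E * R\<close> arising from both
    products cancel; all that remains carries one more factor \<open>L\<close>.\<close>
  have "euler_num C W (Suc m) =
      L ^ Suc (Suc m) * ([:0, 1:] * (E * pderiv R - of_nat (Suc m) * R * pderiv E))"
    unfolding euler_num.simps N' unfolding W' R unfolding E
    by (simp add: algebra_simps del: mult_pCons_left mult_pCons_right)
  then show ?case unfolding L_def by (rule dvdI)
qed

lemma not_is_pole_poly_quotient: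
  fixes P Q :: "complex poly"
  assumes "poly Q z \<noteq> 0"
  shows "\<not> is_pole (\<lambda>x. poly P x / poly Q x) z"
proof -
  have "(\<lambda>x. poly P x / poly Q x) \<midarrow>z\<rightarrow> poly P z / poly Q z"
    using assms by (intro tendsto_intros)
  then show ?thesis
    unfolding is_pole_def using not_tendsto_and_filterlim_at_infinity[OF at_neq_bot] by blast
qed

text \<open>The hypothesis \<open>cancel\<close> rules out partial cancellation: either
  \<open>P\<close> is nonzero at \<open>z\<close> and the pole has full order, or the whole factor
  cancels and there is no pole.\<close>

lemma pole_poly_quotient_power:
  fixes P W :: "complex poly"
  assumes pole: "is_pole (\<lambda>x. poly P x / poly (W ^ k) x) z"
    and simple: "poly W z = 0 \<Longrightarrow> poly (pderiv W) z \<noteq> 0"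
    and cancel: "poly W z = 0 \<Longrightarrow> poly P z = 0 \<Longrightarrow> [:-z, 1:] ^ k dvd P"
  shows "poly W z = 0" "zorder (\<lambda>x. poly P x / poly (W ^ k) x) z = - int k"
proof -
  show root: "poly W z = 0"
    using pole not_is_pole_poly_quotient[of "W ^ k" z P] by auto
  then obtain E where E: "W = [:-z, 1:] * E" by (auto simp: poly_eq_0_iff_dvd elim: dvdE)
  have Ez: "poly E z \<noteq> 0"
    using simple[OF root] unfolding E pderiv_mult by (auto simp: pderiv_pCons)
  have Pz: "poly P z \<noteq> 0"
  proof
    assume "poly P z = 0"
    with cancel root obtain R where R: "P = [:-z, 1:] ^ k * R" by (auto elim: dvdE)
    have "is_pole (\<lambda>x. poly P x / poly (W ^ k) x) z = is_pole (\<lambda>x. poly R x / poly (E ^ k) x) z"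
      by (intro is_pole_cong refl)
        (auto simp: eventually_at_filter R E power_mult_distrib simp flip: left_diff_distrib
          intro!: always_eventually)
    with pole not_is_pole_poly_quotient[of "E ^ k" z R] Ez show False by simp
  qed
  \<comment> \<open>Near \<open>z\<close> the quotient is \<open>(x - z)\<close> to the power
    \<open>-k\<close> times \<open>P / E ^ k\<close>, which is holomorphic where \<open>E\<close>
    does not vanish and nonzero at \<open>z\<close>.\<close>
  show "zorder (\<lambda>x. poly P x / poly (W ^ k) x) z = - int k"
  proof (rule zorder_eqI)
    show "open {x. poly E x \<noteq> 0}"
      by (intro open_Collect_neq continuous_intros)
    show "(\<lambda>x. poly P x / poly E x ^ k) holomorphic_on {x. poly E x \<noteq> 0}"
      by (intro holomorphic_intros) auto
  qed (use Ez Pz in \<open>auto simp: E power_mult_distrib power_int_minus divide_inverse mult_ac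
      simp flip: left_diff_distrib\<close>)
qed

text \<open>Subtracting the series shifted by \<open>n\<close> cancels every coefficient from index
  \<open>n\<close> on and leaves one period.\<close>

lemma periodic_fps_mult:
  fixes a :: "nat \<Rightarrow> 'a::comm_ring_1"
  assumes "\<And>k. a (k + n) = a k"
  shows "Abs_fps a * fps_of_poly (1 - monom 1 n) = fps_of_poly (\<Sum>k<n. monom (a k) k)"
proof (rule fps_ext)
  fix k
  have "a (k - n) = a k" if "n \<le> k"
    using assms[of "k - n"] that by simp
  then show "(Abs_fps a * fps_of_poly (1 - monom 1 n)) $ k = fps_of_poly (\<Sum>k<n. monom (a k) k) $ k"
    by (auto simp: fps_of_poly_diff fps_of_poly_monom' right_diff_distrib coeff_sum
        fps_X_power_mult_right_nth)
qed

theorem theorem4: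
  fixes c :: "int \<Rightarrow> complex" and n m :: nat
  assumes "minimum_period c n"
  shows "\<exists>P Q :: complex poly. poly Q 0 \<noteq> 0 \<and>
           (\<lambda>x. poly P x / poly Q x) has_fps_expansion
             Abs_fps (\<lambda>k. c (int k) * of_nat k ^ m) \<and>
           (\<forall>z. is_pole (\<lambda>x. poly P x / poly Q x) z \<longrightarrow>
                  z ^ n = 1 \<and> zorder (\<lambda>x. poly P x / poly Q x) z = - (int m + 1))"
proof -
  have n: "n > 0" and c: "\<And>k. c (k + int n) = c k"
    using assms by (auto simp: minimum_period_def period_def)
  define W C where "W = (1 - monom 1 n :: complex poly)" and "C = (\<Sum>k<n. monom (c (int k)) k)"
  define P where "P = euler_num C W m"
  have root_iff: "poly W z = 0 \<longleftrightarrow> z ^ n = 1" for z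
    by (auto simp: W_def poly_monom)
  \<comment> \<open>Since \<open>W\<close> takes the value 1 at 0, its roots are nonzero, and there
    the derivative \<open>- n * z ^ (n - 1)\<close> does not vanish.\<close>
  have simple: "poly (pderiv W) z \<noteq> 0" and nonzero: "z \<noteq> 0" if "poly W z = 0" for z
    using that n by (auto simp: W_def poly_monom pderiv_diff pderiv_monom power_0_left)
  have W0: "poly W 0 \<noteq> 0"
    using nonzero by blast
  have "Abs_fps (\<lambda>k. c (int k)) * fps_of_poly W = fps_of_poly C"
    unfolding W_def C_def by (intro periodic_fps_mult) (simp add: c)
  then have series: "Abs_fps (\<lambda>k. c (int k) * of_nat k ^ m) * fps_of_poly (W ^ Suc m) = fps_of_poly P"
    unfolding P_def fps_of_poly_power by (rule fps_mult_power_eq_euler_num)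
  have poly_expansion: "poly p has_fps_expansion fps_of_poly p" for p :: "complex poly"
    by (simp add: has_fps_expansion_def)
  \<comment> \<open>A nonzero constant term permits division both of the power series and of the
    functions at 0.\<close>
  have nth0: "fps_of_poly (W ^ Suc m) $ 0 \<noteq> 0"
    using W0 unfolding fps_of_poly_nth poly_0_coeff_0[symmetric] by simp
  from nth0 have "fps_of_poly (W ^ Suc m) \<noteq> 0"
    by (metis fps_zero_nth)
  with series have "Abs_fps (\<lambda>k. c (int k) * of_nat k ^ m) = fps_of_poly P / fps_of_poly (W ^ Suc m)"
    by (metis nonzero_mult_div_cancel_right)
  then have expansion: "(\<lambda>x. poly P x / poly (W ^ Suc m) x) has_fps_expansion
      Abs_fps (\<lambda>k. c (int k) * of_nat k ^ m)"
    using has_fps_expansion_divide'[OF poly_expansion poly_expansion nth0, of P] by simp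
  have cancel: "[:-z, 1:] ^ Suc m dvd P" if "poly W z = 0" "poly P z = 0" for z
  proof -
    \<comment> \<open>If \<open>C\<close> were nonzero at \<open>z\<close>, so would be
      \<open>P\<close>. Hence \<open>z\<close> is a common root of \<open>W\<close> and
      \<open>C\<close>, the regular case.\<close>
    have "poly C z = 0"
      using poly_euler_num_nonzero[of z W C m] that simple nonzero by (auto simp: P_def)
    then show ?thesis
      using that power_dvd_euler_num unfolding P_def poly_eq_0_iff_dvd by blast
  qed
  have "z ^ n = 1 \<and> zorder (\<lambda>x. poly P x / poly (W ^ Suc m) x) z = - (int m + 1)"
    if pole: "is_pole (\<lambda>x. poly P x / poly (W ^ Suc m) x) z" for z
  proof -
    have "poly W z = 0"
      by (rule pole_poly_quotient_power(1)[OF pole]) (fact simple, fact cancel)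
    moreover have "zorder (\<lambda>x. poly P x / poly (W ^ Suc m) x) z = - int (Suc m)"
      by (rule pole_poly_quotient_power(2)[OF pole]) (fact simple, fact cancel)
    ultimately show ?thesis
      unfolding root_iff by simp
  qed
  with expansion W0 show ?thesis
    by (intro exI[of _ P] exI[of _ "W ^ Suc m"]) (simp del: power_Suc)
qed

end
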